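(* Let $I,J,K\ge 2$. For almost all $\mathcal{Z}\in\mathbb{R}^{I\times J\times K}$ with $\mathrm{rank}(\mathcal{Z})>2$ the following holds: if all locally best approximations $\mathcal{X}_i$ of $\mathcal{Z}$ from $M_{(2,2,2)}(I,J,K)$ satisfy $\mathrm{rank}(\mathcal{X}_i)=3$, then $\mathcal{Z}$ does not have a best rank-$2$ approximation.
   Context: All tensors are real order-3 arrays and $\|\cdot\|_F$ is the Frobenius norm. The rank of $\mathcal{Y}\in\mathbb{R}^{I\times J\times K}$ is the least $R$ such that $\mathcal{Y}$ is a sum of $R$ outer products $\mathbf{a}_r\circ\mathbf{b}_r\circ\mathbf{c}_r$ (entries $a_ib_jc_k$) of real vectors. $S_2(I,J,K)$ is the set of $\mathcal{Y}\in\mathbb{R}^{I\times J\times K}$ with rank at most $2$; a best rank-2 approximation of $\mathcal{Z}$ is a (global) minimizer of $\|\mathcal{Z}-\mathcal{Y}\|_F^2$ over $\mathcal{Y}\in S_2(I,J,K)$. The multilinear rank $\mathrm{mrank}(\mathcal{Y})$ is the triple of dimensions of the spans of the mode-1, mode-2 and mode-3 fibers of $\mathcal{Y}$ (vectors obtained by varying one index and fixing the other two). $M_{(2,2,2)}(I,J,K)$ is the set of $\mathcal{Y}\in\mathbb{R}^{I\times J\times K}$ with $\mathrm{mrank}(\mathcal{Y})\le(2,2,2)$ componentwise. A locally best approximation of $\mathcal{Z}$ from $M_{(2,2,2)}(I,J,K)$ is a local minimizer of $\|\mathcal{Z}-\mathcal{Y}\|_F^2$ over $\mathcal{Y}\in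 M_{(2,2,2)}(I,J,K)$. "For almost all $\mathcal{Z}$ with property Q, P holds" means that the set of $\mathcal{Z}$ having Q but not P has Lebesgue measure zero in $\mathbb{R}^{I\times J\times K}$. *)

theory Defs
  imports "HOL-Analysis.Analysis"
begin

text \<open>The entry \<open>(i, j, k)\<close> of \<open>Y\<close> is \<open>Y $ i $ j $ k\<close>; the sizes are the
  cardinalities of the index types.\<close>

type_synonym ('i, 'j, 'k) tensor = "real ^ 'k ^ 'j ^ 'i"

text \<open>The library norm on this type is the Frobenius norm.\<close>

lemma norm_tensor_power2:
  fixes Y :: "('i::finite, 'j::finite, 'k::finite) tensor"
  shows "(norm Y)\<^sup>2 = (\<Sum>i\<in>UNIV. \<Sum>j\<in>UNIV. \<Sum>k\<in>UNIV. (Y $ i $ j $ k)\<^sup>2)"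
  by (simp add: norm_vec_def L2_set_def sum_nonneg)

definition outer :: "real ^ 'i \<Rightarrow> real ^ 'j \<Rightarrow> real ^ 'k \<Rightarrow> ('i::finite, 'j::finite, 'k::finite) tensor"
  where "outer a b c = (\<chi> i j k. a $ i * b $ j * c $ k)"

definition tensor_rank :: "('i::finite, 'j::finite, 'k::finite) tensor \<Rightarrow> nat"
  where "tensor_rank Y =
    (LEAST R. \<exists>a b c. Y = (\<Sum>r<R. outer (a r) (b r) (c r)))"

text \<open>\<open>dim\<close> of a set of vectors is the dimension of its span, and \<open>\<le>\<close> on tuples
  is componentwise.\<close>

definition mrank :: "('i::finite, 'j::finite, 'k::finite) tensor \<Rightarrow> nat \<times> nat \<times> nat"
  where "mrank Y =
    (dim {(\<chi> i. Y $ i $ j $ k) | j k. True},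
     dim {(\<chi> j. Y $ i $ j $ k) | i k. True},
     dim {(\<chi> k. Y $ i $ j $ k) | i j. True})"

definition S2 :: "('i::finite, 'j::finite, 'k::finite) tensor set"
  where "S2 = {Y. tensor_rank Y \<le> 2}"

definition M222 :: "('i::finite, 'j::finite, 'k::finite) tensor set"
  where "M222 = {Y. mrank Y \<le> (2, 2, 2)}"

definition best_rank2_approx ::
    "('i::finite, 'j::finite, 'k::finite) tensor \<Rightarrow> ('i, 'j, 'k) tensor \<Rightarrow> bool"
  where "best_rank2_approx Z X \<longleftrightarrow>
    X \<in> S2 \<and> (\<forall>Y\<in>S2. (norm (Z - X))\<^sup>2 \<le> (norm (Z - Y))\<^sup>2)"

definition locally_best_M222_approx ::
    "('i::finite, 'j::finite, 'k::finite) tensor \<Rightarrow> ('i, 'j, 'k) tensor \<Rightarrow> bool"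
  where "locally_best_M222_approx Z X \<longleftrightarrow>
    X \<in> M222 \<and>
    (\<exists>e>0. \<forall>Y\<in>M222. norm (Y - X) < e \<longrightarrow> (norm (Z - X))\<^sup>2 \<le> (norm (Z - Y))\<^sup>2)"

end

theory Submission
  imports Defs
begin

text \<open>
  Let \<open>Y = a1 \<circ> b1 \<circ> c1 + a2 \<circ> b2 \<circ> c2\<close> be a best rank-2 approximation of \<open>Z\<close>, where \<open>Z\<close> has
  rank greater than 2.  If in each mode the two vectors are independent, the hyperdeterminant of a
  suitable \<open>2 \<times> 2 \<times> 2\<close> subarray is positive at \<open>Y\<close>, hence near \<open>Y\<close>, and this forces rank at most 2
  on \<open>M222\<close>.  So \<open>Y\<close> is a locally best approximation from \<open>M222\<close>, of rank at most 2.  If \<open>Y\<close> has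
  rank at most 1, a rank-1 correction of the residual shows \<open>Z = Y\<close>.

  There remains \<open>Y = A \<circ> c\<close> with \<open>A\<close> a matrix of rank 2, up to permuting the modes.  Let \<open>U\<close>, \<open>V\<close> be
  the column and row space of \<open>A\<close>.  The first-order conditions say that \<open>R = Z - Y\<close> is orthogonal to
  \<open>U \<otimes> V \<otimes> w\<close>, \<open>U \<otimes> v \<otimes> c\<close> and \<open>u \<otimes> V \<otimes> c\<close> for all \<open>u\<close>, \<open>v\<close>, \<open>w\<close>.  The pairs \<open>(Y, R)\<close> form a
  family of dimension \<open>I J K - 3 (K - 1)\<close>, parametrized by polynomials, so these \<open>Z\<close> form a null set.
\<close>

section \<open>Tensors of rank at most 2 and first-order conditions\<close>

lemma outer_nth [simp]: "outer a b c $ i $ j $ k = a $ i * b $ j * c $ k"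
  by (simp add: outer_def)

lemma outer_zero [simp]: "outer 0 b c = 0"
  by (simp add: vec_eq_iff)

lemma tensor_eq_sum_outer:
  fixes Y :: "('i::finite, 'j::finite, 'k::finite) tensor"
  shows "\<exists>R a b c. Y = (\<Sum>r<R::nat. outer (a r) (b r) (c r))"
proof -
  let ?U = "UNIV :: ('i \<times> 'j \<times> 'k) set"
  obtain h where h: "bij_betw h {0..<card ?U} ?U"
    using ex_bij_betw_nat_finite[of ?U] by auto
  let ?a = "\<lambda>p::'i\<times>'j\<times>'k. (\<chi> i. if i = fst p then Y $ fst p $ fst (snd p) $ snd (snd p) else 0)"
  let ?b = "\<lambda>p::'i\<times>'j\<times>'k. axis (fst (snd p)) (1::real)"
  let ?c = "\<lambda>p::'i\<times>'j\<times>'k. axis (snd (snd p)) (1::real)"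
  have "Y = (\<Sum>p\<in>?U. outer (?a p) (?b p) (?c p))"
  proof -
    have "(\<Sum>p\<in>?U. outer (?a p) (?b p) (?c p)) $ i $ j $ k = Y $ i $ j $ k" for i j k
    proof -
      have "(\<Sum>p\<in>?U. outer (?a p) (?b p) (?c p)) $ i $ j $ k
          = (\<Sum>p\<in>?U. if p = (i, j, k) then Y $ i $ j $ k else 0)"
        unfolding sum_component by (intro sum.cong) (auto simp: axis_def)
      then show ?thesis by simp
    qed
    then show ?thesis by (simp add: vec_eq_iff)
  qed
  also have "\<dots> = (\<Sum>r<card ?U. outer (?a (h r)) (?b (h r)) (?c (h r)))"
    using sum.reindex_bij_betw[OF h, of "\<lambda>p. outer (?a p) (?b p) (?c p)"]
    by (simp add: atLeast0LessThan)
  finally show ?thesis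
    by (intro exI[of _ "card ?U"] exI[of _ "\<lambda>r. ?a (h r)"] exI[of _ "\<lambda>r. ?b (h r)"] exI[of _ "\<lambda>r. ?c (h r)"])
qed

lemma tensor_rank_le_iff:
  "tensor_rank Y \<le> R \<longleftrightarrow> (\<exists>a b c. Y = (\<Sum>r<R. outer (a r) (b r) (c r)))"
proof
  assume le: "tensor_rank Y \<le> R"
  obtain a b c where Y: "Y = (\<Sum>r<tensor_rank Y. outer (a r) (b r) (c r))"
    using LeastI_ex[OF tensor_eq_sum_outer[of Y], folded tensor_rank_def] by auto
  \<comment> \<open>Zero terms pad the decomposition to length exactly \<open>R\<close>; a zero
    first factor already makes a term vanish.\<close>
  let ?a = "\<lambda>r. if r < tensor_rank Y then a r else 0"
  have "Y = (\<Sum>r<R. outer (?a r) (b r) (c r))"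
    by (subst Y, rule sum.mono_neutral_cong_left) (use le in auto)
  then show "\<exists>a b c. Y = (\<Sum>r<R. outer (a r) (b r) (c r))"
    by (intro exI[of _ ?a] exI[of _ b] exI[of _ c])
next
  assume "\<exists>a b c. Y = (\<Sum>r<R. outer (a r) (b r) (c r))"
  then show "tensor_rank Y \<le> R"
    unfolding tensor_rank_def by (rule Least_le)
qed

lemma mem_S2_iff:
  "Y \<in> S2 \<longleftrightarrow> (\<exists>a1 b1 c1 a2 b2 c2. Y = outer a1 b1 c1 + outer a2 b2 c2)"
proof
  assume "Y \<in> S2"
  then show "\<exists>a1 b1 c1 a2 b2 c2. Y = outer a1 b1 c1 + outer a2 b2 c2"
    unfolding S2_def mem_Collect_eq tensor_rank_le_iff
    unfolding numeral_2_eq_2 lessThan_Suc by auto metis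
next
  assume "\<exists>a1 b1 c1 a2 b2 c2. Y = outer a1 b1 c1 + outer a2 b2 c2"
  then obtain a1 b1 c1 a2 b2 c2 where Y: "Y = outer a1 b1 c1 + outer a2 b2 c2" by blast
  show "Y \<in> S2"
    unfolding S2_def tensor_rank_le_iff mem_Collect_eq
    by (intro exI[of _ "\<lambda>r. if r = 0 then a1 else a2"] exI[of _ "\<lambda>r. if r = 0 then b1 else b2"]
        exI[of _ "\<lambda>r. if r = 0 then c1 else c2"]) (simp add: Y numeral_2_eq_2)
qed

section \<open>First-order conditions at a minimizer over \<open>S2\<close>\<close>

lemma inner_eq_0_if_norm_minimal:
  fixes R D :: "'a::real_inner"
  assumes "\<And>t. (norm R)\<^sup>2 \<le> (norm (R - t *\<^sub>R D))\<^sup>2"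
  shows "R \<bullet> D = 0"
proof (cases "D = 0")
  case False
  \<comment> \<open>The vertex of the parabola in \<open>t\<close>; there the squared norm has
    dropped by \<open>(R \<bullet> D)\<^sup>2 / (D \<bullet> D)\<close>.\<close>
  let ?t = "(R \<bullet> D) / (D \<bullet> D)"
  have D: "D \<bullet> D > 0" using False by simp
  have "(norm (R - ?t *\<^sub>R D))\<^sup>2 = R \<bullet> R - 2 * ?t * (R \<bullet> D) + ?t\<^sup>2 * (D \<bullet> D)"
    unfolding power2_norm_eq_inner
    by (simp add: inner_diff_left inner_diff_right inner_commute[of D R] power2_eq_square)
  also have "\<dots> = R \<bullet> R - (R \<bullet> D)\<^sup>2 / (D \<bullet> D)"
    using D by (simp add: power2_eq_square divide_simps)
  finally have "(R \<bullet> D)\<^sup>2 / (D \<bullet> D) \<le> 0"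
    using assms[of ?t] by (simp add: power2_norm_eq_inner)
  then show ?thesis using D by (simp add: divide_le_0_iff)
qed simp

text \<open>\<open>S2\<close> need not be convex, so only directions whose whole line through
  \<open>Y\<close> stays in \<open>S2\<close> are tested. Varying one factor in a decomposition of
  \<open>Y\<close> gives such directions.\<close>

lemma best_rank2_approx_first_order:
  assumes best: "best_rank2_approx Z Y" and line: "\<And>t. Y + t *\<^sub>R D \<in> S2"
  shows "(Z - Y) \<bullet> D = 0"
proof (rule inner_eq_0_if_norm_minimal)
  fix t show "(norm (Z - Y))\<^sup>2 \<le> (norm (Z - Y - t *\<^sub>R D))\<^sup>2"
    using best line[of t] unfolding best_rank2_approx_def by (metis diff_diff_eq)
qed

lemma scaleR_outer:
  "t *\<^sub>R outer a b c = outer a b (t *\<^sub>R c)"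
  "t *\<^sub>R outer a b c = outer a (t *\<^sub>R b) c"
  "t *\<^sub>R outer a b c = outer (t *\<^sub>R a) b c"
  by (simp_all add: vec_eq_iff)

lemma outer_add1: "outer (a + a') b c = outer a b c + outer a' b c"
  and outer_add2: "outer a (b + b') c = outer a b c + outer a b' c"
  and outer_add3: "outer a b (c + c') = outer a b c + outer a b c'"
  by (simp_all add: vec_eq_iff algebra_simps)

lemma outer_diff2: "outer a (b - b') c = outer a b c - outer a b' c"
  by (simp_all add: vec_eq_iff algebra_simps)

lemma inner_outer:
  fixes X :: "('i::finite, 'j::finite, 'k::finite) tensor"
  shows "X \<bullet> outer a b c = (\<Sum>i\<in>UNIV. \<Sum>j\<in>UNIV. \<Sum>k\<in>UNIV. a $ i * b $ j * c $ k * X $ i $ j $ k)"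
  by (simp add: inner_vec_def mult_ac)

lemma outer_axis: "outer (axis i 1) (axis j 1) (axis k 1) = axis i (axis j (axis k 1))"
  by (simp add: vec_eq_iff axis_def)

text \<open>The second summand is still free, so the residual is orthogonal to every outer product,
  in particular to the unit tensors.\<close>

lemma best_rank2_approx_rank1_imp_eq:
  assumes "best_rank2_approx Z (outer a b c)"
  shows "Z = outer a b c"
proof -
  have "(Z - outer a b c) $ i $ j $ k = 0" for i j k
  proof -
    have "(Z - outer a b c) \<bullet> outer (axis i 1) (axis j 1) (axis k 1) = 0"
      by (rule best_rank2_approx_first_order[OF assms])
         (unfold mem_S2_iff scaleR_outer(1), intro exI, rule refl)
    then show ?thesis
      by (simp add: outer_axis inner_axis)
  qed
  then show ?thesis by (simp add: vec_eq_iff)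
qed

lemma best_rank2_approx_rank_gt_2:
  assumes "best_rank2_approx Z (outer a b c)"
  shows "\<not> tensor_rank Z > 2"
proof -
  have "Z = outer a b c + outer 0 b c" using best_rank2_approx_rank1_imp_eq[OF assms] by simp
  then have "Z \<in> S2" unfolding mem_S2_iff by blast
  then show ?thesis by (simp add: S2_def)
qed

text \<open>Linear independence, encoded by a nonzero minor: this supplies explicit indices, and a
  nonzero minor persists under small perturbations.\<close>

definition indep2 :: "real ^ 'n \<Rightarrow> real ^ 'n \<Rightarrow> bool"
  where "indep2 v w \<longleftrightarrow> (\<exists>i j. v $ i * w $ j \<noteq> v $ j * w $ i)"

lemma not_indep2E:
  assumes "\<not> indep2 v w"
  obtains u s t where "v = s *\<^sub>R u" "w = t *\<^sub>R u"
proof (cases "v = 0")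
  case True
  then show ?thesis using that[of 0 w 1] by simp
next
  case False
  then obtain i where i: "v $ i \<noteq> 0" by (auto simp: vec_eq_iff)
  have "w = (w $ i / v $ i) *\<^sub>R v"
  proof (subst vec_eq_iff, intro allI)
    fix j
    have "v $ i * w $ j = v $ j * w $ i" using assms by (auto simp: indep2_def)
    then show "w $ j = ((w $ i / v $ i) *\<^sub>R v) $ j" using i by (simp add: field_simps)
  qed
  then show ?thesis using that[of 1 v] by simp
qed

section \<open>Interior points of \<open>S2\<close> in \<open>M222\<close>\<close>

text \<open>Zeros are taken as points of the projective line, so that a vanishing leading
  coefficient is covered; the last condition makes the two points distinct.\<close>

lemma quadratic_form_two_zeros:
  fixes \<alpha> \<beta> \<gamma> :: real
  assumes disc: "\<beta>\<^sup>2 - 4 * \<alpha> * \<gamma> > 0"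
  obtains l m l' m' where "\<alpha> * l\<^sup>2 + \<beta> * l * m + \<gamma> * m\<^sup>2 = 0"
    "\<alpha> * l'\<^sup>2 + \<beta> * l' * m' + \<gamma> * m'\<^sup>2 = 0" "l * m' - l' * m \<noteq> 0"
proof (cases "\<alpha> = 0")
  case True
  then have "\<beta> \<noteq> 0" using disc by auto
  then show ?thesis using that[of 1 0 "-\<gamma>" \<beta>] True by (simp add: power2_eq_square)
next
  case False
  define s where "s = sqrt (\<beta>\<^sup>2 - 4 * \<alpha> * \<gamma>)"
  have s: "s * s = \<beta> * \<beta> - 4 * \<alpha> * \<gamma>" "s \<noteq> 0"
    using disc by (auto simp: s_def power2_eq_square simp flip: real_sqrt_mult)
  have root: "\<alpha> * (-\<beta> + u)\<^sup>2 + \<beta> * (-\<beta> + u) * (2 * \<alpha>) + \<gamma> * (2 * \<alpha>)\<^sup>2 = 0"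
    if "u * u = \<beta> * \<beta> - 4 * \<alpha> * \<gamma>" for u
  proof -
    have "\<alpha> * (-\<beta> + u)\<^sup>2 + \<beta> * (-\<beta> + u) * (2 * \<alpha>) + \<gamma> * (2 * \<alpha>)\<^sup>2
        = \<alpha> * (u * u - (\<beta> * \<beta> - 4 * \<alpha> * \<gamma>))"
      by (simp add: power2_eq_square algebra_simps)
    then show ?thesis using that by simp
  qed
  show ?thesis
    using that[OF root[of s] root[of "-s"]] s False by (simp add: algebra_simps)
qed

lemma det2_zero_imp_rank1:
  fixes m :: "bool \<Rightarrow> bool \<Rightarrow> real"
  assumes "m False False * m True True = m False True * m True False"
  obtains x y where "\<And>r s. m r s = x r * y s"
proof (cases "\<exists>r s. m r s \<noteq> 0")
  case True
  then obtain r0 s0 where nz: "m r0 s0 \<noteq> 0" by blast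
  have *: "m r s * m r0 s0 = m r s0 * m r0 s" for r s
    using assms by (cases r; cases s; cases r0; cases s0) (auto simp: mult_ac)
  have "m r s = (m r s0 / m r0 s0) * m r0 s" for r s
    using nz *[of r s] by (simp add: field_simps)
  then show ?thesis by (rule that)
next
  case False
  then show ?thesis using that[of "\<lambda>_. 0" "\<lambda>_. 0"] by auto
qed

text \<open>The discriminant of the binary quadratic form \<open>det (l M\<^sub>0 + m M\<^sub>1)\<close>, where \<open>M\<^sub>0\<close>, \<open>M\<^sub>1\<close> are the two
  slices of \<open>g\<close>.  If it is positive, the pencil contains two independent matrices of rank at most 1.\<close>

definition hyperdet :: "(bool \<Rightarrow> bool \<Rightarrow> bool \<Rightarrow> real) \<Rightarrow> real"
  where "hyperdet g =
    (g False False False * g True True True + g True True False * g False False True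
      - g False True False * g True False True - g True False False * g False True True)\<^sup>2
    - 4 * (g False False False * g True True False - g False True False * g True False False)
        * (g False False True * g True True True - g False True True * g True False True)"

text \<open>Cramer's rule writes both slices of \<open>g\<close> as combinations of the two rank-1
  members of the pencil. The coefficients are the third factors.\<close>

lemma hyperdet_pos_imp_rank2:
  assumes "hyperdet g > 0"
  obtains x y z x' y' z' where "\<And>r s t. g r s t = x r * y s * z t + x' r * y' s * z' t"
proof -
  let ?\<alpha> = "g False False False * g True True False - g False True False * g True False False"
  let ?\<beta> = "g False False False * g True True True + g True True False * g False False True
      - g False True False * g True False True - g True False False * g False True True"
  let ?\<gamma> = "g False False True * g True True True - g False True True * g True False True"
  obtain l m l' m' where z: "?\<alpha> * l\<^sup>2 + ?\<beta> * l * m + ?\<gamma> * m\<^sup>2 = 0"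
    "?\<alpha> * l'\<^sup>2 + ?\<beta> * l' * m' + ?\<gamma> * m'\<^sup>2 = 0" and D: "l * m' - l' * m \<noteq> 0"
    using quadratic_form_two_zeros assms unfolding hyperdet_def by metis
  let ?N = "\<lambda>l m r s. l * g r s False + m * g r s True"
  obtain x y where xy: "\<And>r s. ?N l m r s = x r * y s"
    by (rule det2_zero_imp_rank1[of "?N l m"]) (use z(1) in \<open>auto simp: power2_eq_square algebra_simps\<close>)
  obtain x' y' where xy': "\<And>r s. ?N l' m' r s = x' r * y' s"
    by (rule det2_zero_imp_rank1[of "?N l' m'"]) (use z(2) in \<open>auto simp: power2_eq_square algebra_simps\<close>)
  let ?D = "l * m' - l' * m"
  have "g r s t = x r * y s * (if t then - l' / ?D else m' / ?D)
      + x' r * y' s * (if t then l / ?D else - m / ?D)" for r s t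
  proof -
    have "g r s False = (m' * ?N l m r s - m * ?N l' m' r s) / ?D"
      "g r s True = (l * ?N l' m' r s - l' * ?N l m r s) / ?D"
      by (subst eq_divide_eq, use D in simp, simp add: algebra_simps)+
    then show ?thesis
      unfolding xy xy' by (cases t) (simp_all add: diff_divide_distrib mult_ac)
  qed
  then show ?thesis by (rule that)
qed

text \<open>\<open>f\<close> and \<open>f'\<close> span a space containing \<open>F\<close>, so a
  vector of \<open>F\<close> is determined by its two coordinates at \<open>\<iota>\<close>. The
  vectors \<open>P r\<close> are the basis dual to these coordinates, found by Cramer's
  rule.\<close>

lemma dim_le_2_interpolation:
  fixes F :: "(real ^ 'n) set"
  assumes dim: "dim F \<le> 2" and f: "f \<in> F" "f' \<in> F"
    and minor: "f $ \<iota> False * f' $ \<iota> True \<noteq> f $ \<iota> True * f' $ \<iota> False"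
  shows "\<exists>P. \<forall>v\<in>F. \<forall>i. v $ i = P False $ i * v $ \<iota> False + P True $ i * v $ \<iota> True"
proof -
  have nz: "f \<noteq> 0" using minor by auto
  have notin: "f' \<notin> span {f}"
  proof
    assume "f' \<in> span {f}"
    then obtain t where "f' = t *\<^sub>R f" by (auto simp: span_singleton)
    then show False using minor by simp
  qed
  then have neq: "f' \<noteq> f" by (metis insertI1 span_base)
  have "independent {f', f}"
    using notin nz neq by (simp add: independent_insert)
  then have F: "F \<subseteq> span {f', f}"
    using card_ge_dim_independent[of "{f', f}" F] f dim neq by simp
  let ?d = "f $ \<iota> False * f' $ \<iota> True - f $ \<iota> True * f' $ \<iota> False"
  let ?P = "\<lambda>r. if r then (1 / ?d) *\<^sub>R (f $ \<iota> False *\<^sub>R f' - f' $ \<iota> False *\<^sub>R f)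
    else (1 / ?d) *\<^sub>R (f' $ \<iota> True *\<^sub>R f - f $ \<iota> True *\<^sub>R f')"
  have "v $ i = ?P False $ i * v $ \<iota> False + ?P True $ i * v $ \<iota> True" if v: "v \<in> F" for v i
  proof -
    obtain s t where v: "v = s *\<^sub>R f' + t *\<^sub>R f"
    proof -
      obtain s where "v - s *\<^sub>R f' \<in> span {f}"
        using v F unfolding span_insert[of f'] by blast
      then obtain t where "v - s *\<^sub>R f' = t *\<^sub>R f" by (auto simp: span_singleton)
      then show ?thesis using that by (metis add.commute diff_add_cancel)
    qed
    have "?d * v $ i = (f' $ \<iota> True * f $ i - f $ \<iota> True * f' $ i) * v $ \<iota> False
      + (f $ \<iota> False * f' $ i - f' $ \<iota> False * f $ i) * v $ \<iota> True"
      by (simp add: v algebra_simps)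
    then have "v $ i = ((f' $ \<iota> True * f $ i - f $ \<iota> True * f' $ i) * v $ \<iota> False
      + (f $ \<iota> False * f' $ i - f' $ \<iota> False * f $ i) * v $ \<iota> True) / ?d"
      using minor by (subst eq_divide_eq) (simp add: mult.commute)
    then show ?thesis by (simp add: add_divide_distrib)
  qed
  then show ?thesis by (intro exI[of _ ?P]) blast
qed

text \<open>The three minors make \<open>Y\<close> the image of its 2 \<times> 2 \<times> 2 subarray
  under one linear map per mode, and such maps send outer products to outer products.\<close>

lemma M222_hyperdet_pos_imp_S2:
  fixes Y :: "('i::finite, 'j::finite, 'k::finite) tensor"
  assumes M: "Y \<in> M222"
    and m1: "Y $ \<iota> False $ j1 $ k1 * Y $ \<iota> True $ j1' $ k1' \<noteq> Y $ \<iota> True $ j1 $ k1 * Y $ \<iota> False $ j1' $ k1'"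
    and m2: "Y $ i2 $ \<kappa> False $ k2 * Y $ i2' $ \<kappa> True $ k2' \<noteq> Y $ i2 $ \<kappa> True $ k2 * Y $ i2' $ \<kappa> False $ k2'"
    and m3: "Y $ i3 $ j3 $ \<tau> False * Y $ i3' $ j3' $ \<tau> True \<noteq> Y $ i3 $ j3 $ \<tau> True * Y $ i3' $ j3' $ \<tau> False"
    and hd: "hyperdet (\<lambda>r s t. Y $ \<iota> r $ \<kappa> s $ \<tau> t) > 0"
  shows "Y \<in> S2"
proof -
  have d: "dim {(\<chi> i. Y $ i $ j $ k) | j k. True} \<le> 2"
    "dim {(\<chi> j. Y $ i $ j $ k) | i k. True} \<le> 2"
    "dim {(\<chi> k. Y $ i $ j $ k) | i j. True} \<le> 2"
    using M by (auto simp: M222_def mrank_def)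
  have "\<exists>P. \<forall>v\<in>{(\<chi> i. Y $ i $ j $ k) | j k. True}. \<forall>i. v $ i = P False $ i * v $ \<iota> False + P True $ i * v $ \<iota> True"
    by (rule dim_le_2_interpolation[OF d(1), of "\<chi> i. Y $ i $ j1 $ k1" "\<chi> i. Y $ i $ j1' $ k1'" \<iota>])
       (use m1 in auto)
  then obtain P where P: "Y $ i $ j $ k = P False $ i * Y $ \<iota> False $ j $ k + P True $ i * Y $ \<iota> True $ j $ k" for i j k
    by fastforce
  have "\<exists>Q. \<forall>v\<in>{(\<chi> j. Y $ i $ j $ k) | i k. True}. \<forall>j. v $ j = Q False $ j * v $ \<kappa> False + Q True $ j * v $ \<kappa> True"
    by (rule dim_le_2_interpolation[OF d(2), of "\<chi> j. Y $ i2 $ j $ k2" "\<chi> j. Y $ i2' $ j $ k2'" \<kappa>])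
       (use m2 in auto)
  then obtain Q where Q: "Y $ i $ j $ k = Q False $ j * Y $ i $ \<kappa> False $ k + Q True $ j * Y $ i $ \<kappa> True $ k" for i j k
    by fastforce
  have "\<exists>S. \<forall>v\<in>{(\<chi> k. Y $ i $ j $ k) | i j. True}. \<forall>k. v $ k = S False $ k * v $ \<tau> False + S True $ k * v $ \<tau> True"
    by (rule dim_le_2_interpolation[OF d(3), of "\<chi> k. Y $ i3 $ j3 $ k" "\<chi> k. Y $ i3' $ j3' $ k" \<tau>])
       (use m3 in auto)
  then obtain S where S: "Y $ i $ j $ k = S False $ k * Y $ i $ j $ \<tau> False + S True $ k * Y $ i $ j $ \<tau> True" for i j k
    by fastforce
  obtain x y z x' y' z' where g: "\<And>r s t. Y $ \<iota> r $ \<kappa> s $ \<tau> t = x r * y s * z t + x' r * y' s * z' t"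
    using hyperdet_pos_imp_rank2[OF hd] by metis
  let ?L = "\<lambda>P x. x False *\<^sub>R P False + x True *\<^sub>R P True"
  have "Y = outer (?L P x) (?L Q y) (?L S z) + outer (?L P x') (?L Q y') (?L S z')"
    unfolding vec_eq_iff
  proof (intro allI)
    fix i j k
    note P[of i j k]
    also have "P False $ i * Y $ \<iota> False $ j $ k + P True $ i * Y $ \<iota> True $ j $ k
      = (\<Sum>r\<in>UNIV. \<Sum>s\<in>UNIV. \<Sum>t\<in>UNIV. P r $ i * Q s $ j * S t $ k * Y $ \<iota> r $ \<kappa> s $ \<tau> t)"
      unfolding Q[of "\<iota> _" j k] S[of "\<iota> _" "\<kappa> _" k] by (simp add: UNIV_bool algebra_simps)
    also have "\<dots> = (outer (?L P x) (?L Q y) (?L S z) + outer (?L P x') (?L Q y') (?L S z')) $ i $ j $ k"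
      unfolding g by (simp add: UNIV_bool algebra_simps)
    finally show "Y $ i $ j $ k = (outer (?L P x) (?L Q y) (?L S z) + outer (?L P x') (?L Q y') (?L S z')) $ i $ j $ k" .
  qed
  then show ?thesis unfolding mem_S2_iff by blast
qed

lemma indep2_outer_minor:
  fixes b1 b2 :: "real ^ 'j" and c1 c2 :: "real ^ 'k"
  assumes "indep2 b1 b2" "indep2 c1 c2"
  obtains j k j' k' where "b1 $ j * c1 $ k * (b2 $ j' * c2 $ k') \<noteq> b2 $ j * c2 $ k * (b1 $ j' * c1 $ k')"
proof -
  obtain j j' where b: "b1 $ j * b2 $ j' \<noteq> b1 $ j' * b2 $ j"
    using assms(1) by (auto simp: indep2_def)
  obtain k k' where c: "c1 $ k * c2 $ k' \<noteq> c1 $ k' * c2 $ k"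
    using assms(2) by (auto simp: indep2_def)
  have False if H: "\<And>j k j' k'. b1 $ j * c1 $ k * (b2 $ j' * c2 $ k') = b2 $ j * c2 $ k * (b1 $ j' * c1 $ k')"
  proof -
    \<comment> \<open>Equal indices in one mode let the minor of the other mode factor out. So
      \<open>b1\<close>, \<open>b2\<close> have disjoint supports, and likewise \<open>c1\<close>,
      \<open>c2\<close>; then some instance of \<open>H\<close> has exactly one nonzero
      side.\<close>
    have bb: "b1 $ l * b2 $ l = 0" for l
    proof -
      have "(b1 $ l * b2 $ l) * (c1 $ k * c2 $ k' - c1 $ k' * c2 $ k) = 0"
        using H[of l k l k'] by (simp add: algebra_simps)
      then show ?thesis using c by simp
    qed
    have cc: "c1 $ l * c2 $ l = 0" for l
    proof -
      have "(c1 $ l * c2 $ l) * (b1 $ j * b2 $ j' - b1 $ j' * b2 $ j) = 0"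
        using H[of j l j' l] by (simp add: algebra_simps)
      then show ?thesis using b by simp
    qed
    show False
      using b c bb[of j] bb[of j'] cc[of k] cc[of k'] H[of j k j' k'] H[of j k' j' k]
      by auto
  qed
  then show ?thesis using that by blast
qed

text \<open>On the pencil the determinant is a constant times the product of the linear forms with
  coefficients \<open>c1\<close> and \<open>c2\<close>. The discriminant of such a product is the
  square of the determinant of the two forms, scaled.\<close>

lemma hyperdet_rank2:
  "hyperdet (\<lambda>r s t. a1 r * b1 s * c1 t + a2 r * b2 s * c2 t)
    = ((a1 False * a2 True - a1 True * a2 False) * (b1 False * b2 True - b1 True * b2 False)
       * (c1 False * c2 True - c1 True * c2 False))\<^sup>2"
proof -
  let ?A = "a1 False * a2 True - a1 True * a2 False" and ?B = "b1 False * b2 True - b1 True * b2 False"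
  let ?g = "\<lambda>r s t. a1 r * b1 s * c1 t + a2 r * b2 s * c2 t"
  have disc: "(D * (u * v + w * z))\<^sup>2 - 4 * (D * (u * w)) * (D * (z * v)) = (D * (u * v - z * w))\<^sup>2"
    for D u v w z :: real by (simp add: power2_eq_square algebra_simps)
  have "?g False False t * ?g True True t' + ?g True True t * ?g False False t'
      - ?g False True t * ?g True False t' - ?g True False t * ?g False True t'
      = ?A * ?B * (c1 t * c2 t' + c2 t * c1 t')" for t t'
    by (simp add: algebra_simps)
  moreover have "?g False False t * ?g True True t - ?g False True t * ?g True False t
      = ?A * ?B * (c1 t * c2 t)" for t
    by (simp add: algebra_simps)
  moreover have "(?A * ?B * (c1 False * c2 True + c2 False * c1 True))\<^sup>2
      - 4 * (?A * ?B * (c1 False * c2 False)) * (?A * ?B * (c1 True * c2 True))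
      = (?A * ?B * (c1 False * c2 True - c1 True * c2 False))\<^sup>2"
    by (rule disc)
  ultimately show ?thesis
    unfolding hyperdet_def by simp
qed

text \<open>Apart from membership in \<open>M222\<close>, the hypotheses of
  \<open>M222_hyperdet_pos_imp_S2\<close> are strict polynomial conditions. They hold at
  \<open>Y\<close>, hence on the open set \<open>W\<close> around it.\<close>

lemma M222_subset_S2_near:
  fixes a1 a2 :: "real ^ 'i::finite" and b1 b2 :: "real ^ 'j::finite" and c1 c2 :: "real ^ 'k::finite"
  assumes a: "indep2 a1 a2" and b: "indep2 b1 b2" and c: "indep2 c1 c2"
  defines "Y \<equiv> outer a1 b1 c1 + outer a2 b2 c2"
  obtains e where "e > 0" "\<And>X. X \<in> M222 \<Longrightarrow> norm (X - Y) < e \<Longrightarrow> X \<in> S2"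
proof -
  obtain i0 i1 where i: "a1 $ i0 * a2 $ i1 \<noteq> a1 $ i1 * a2 $ i0"
    using a by (auto simp: indep2_def)
  obtain j0 j1 where j: "b1 $ j0 * b2 $ j1 \<noteq> b1 $ j1 * b2 $ j0"
    using b by (auto simp: indep2_def)
  obtain k0 k1 where k: "c1 $ k0 * c2 $ k1 \<noteq> c1 $ k1 * c2 $ k0"
    using c by (auto simp: indep2_def)
  define \<iota> \<kappa> \<tau> where "\<iota> = (\<lambda>r. if r then i1 else i0)" and "\<kappa> = (\<lambda>r. if r then j1 else j0)"
    and "\<tau> = (\<lambda>r. if r then k1 else k0)"
  obtain p p' q q' where m1: "b1 $ p * c1 $ q * (b2 $ p' * c2 $ q') \<noteq> b2 $ p * c2 $ q * (b1 $ p' * c1 $ q')"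
    using indep2_outer_minor[OF b c] .
  obtain u u' v v' where m2: "a1 $ u * c1 $ v * (a2 $ u' * c2 $ v') \<noteq> a2 $ u * c2 $ v * (a1 $ u' * c1 $ v')"
    using indep2_outer_minor[OF a c] .
  obtain x x' y y' where m3: "a1 $ x * b1 $ y * (a2 $ x' * b2 $ y') \<noteq> a2 $ x * b2 $ y * (a1 $ x' * b1 $ y')"
    using indep2_outer_minor[OF a b] .
  define W where "W = {X :: ('i, 'j, 'k) tensor.
      X $ \<iota> False $ p $ q * X $ \<iota> True $ p' $ q' \<noteq> X $ \<iota> True $ p $ q * X $ \<iota> False $ p' $ q'}
    \<inter> {X. X $ u $ \<kappa> False $ v * X $ u' $ \<kappa> True $ v' \<noteq> X $ u $ \<kappa> True $ v * X $ u' $ \<kappa> False $ v'}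
    \<inter> {X. X $ x $ y $ \<tau> False * X $ x' $ y' $ \<tau> True \<noteq> X $ x $ y $ \<tau> True * X $ x' $ y' $ \<tau> False}
    \<inter> {X. 0 < hyperdet (\<lambda>r s t. X $ \<iota> r $ \<kappa> s $ \<tau> t)}"
  have "open W"
    unfolding W_def hyperdet_def
    by (intro open_Int open_Collect_neq open_Collect_less continuous_intros)
  \<comment> \<open>Multiplicativity of the 2 \<times> 2 determinant: each minor of \<open>Y\<close>
    is a minor of one pair of factors times a minor from the other two modes.\<close>
  have minor_ne: "(s * X + t * X') * (s' * W + t' * W') \<noteq> (s' * X + t' * X') * (s * W + t * W')"
    if "s * t' \<noteq> s' * t" "X * W' \<noteq> X' * W" for s t s' t' X X' W W' :: real
  proof -
    have "(s * X + t * X') * (s' * W + t' * W') - (s' * X + t' * X') * (s * W + t * W')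
      = (s * t' - s' * t) * (X * W' - X' * W)" by algebra
    then show ?thesis using that by (metis eq_iff_diff_eq_0 mult_eq_0_iff)
  qed
  have "Y \<in> W"
    unfolding W_def
  proof (intro IntI CollectI)
    show "Y $ \<iota> False $ p $ q * Y $ \<iota> True $ p' $ q' \<noteq> Y $ \<iota> True $ p $ q * Y $ \<iota> False $ p' $ q'"
      using minor_ne[OF i m1] by (simp add: Y_def \<iota>_def mult_ac)
    show "Y $ u $ \<kappa> False $ v * Y $ u' $ \<kappa> True $ v' \<noteq> Y $ u $ \<kappa> True $ v * Y $ u' $ \<kappa> False $ v'"
      using minor_ne[OF j m2] by (simp add: Y_def \<kappa>_def mult_ac)
    show "Y $ x $ y $ \<tau> False * Y $ x' $ y' $ \<tau> True \<noteq> Y $ x $ y $ \<tau> True * Y $ x' $ y' $ \<tau> False"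
      using minor_ne[OF k m3] by (simp add: Y_def \<tau>_def mult_ac)
    show "0 < hyperdet (\<lambda>r s t. Y $ \<iota> r $ \<kappa> s $ \<tau> t)"
      using hyperdet_rank2[of "\<lambda>r. a1 $ \<iota> r" "\<lambda>r. b1 $ \<kappa> r" "\<lambda>r. c1 $ \<tau> r" "\<lambda>r. a2 $ \<iota> r" "\<lambda>r. b2 $ \<kappa> r" "\<lambda>r. c2 $ \<tau> r"]
        i j k by (simp add: Y_def \<iota>_def \<kappa>_def \<tau>_def)
  qed
  with \<open>open W\<close> obtain e where e: "e > 0" "\<And>X. dist X Y < e \<Longrightarrow> X \<in> W"
    unfolding open_dist by blast
  have "X \<in> S2" if "X \<in> M222" "norm (X - Y) < e" for X
  proof -
    have "X \<in> W" using e(2) that(2) by (simp add: dist_norm)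
    then show ?thesis
      unfolding W_def Int_iff mem_Collect_eq
      by (elim conjE) (rule M222_hyperdet_pos_imp_S2[OF that(1)])
  qed
  with e(1) show ?thesis by (rule that)
qed

lemma S2_subset_M222: "S2 \<subseteq> M222"
proof
  fix Y :: "('i::finite, 'j::finite, 'k::finite) tensor" assume "Y \<in> S2"
  then obtain a1 b1 c1 a2 b2 c2 where Y: "Y = outer a1 b1 c1 + outer a2 b2 c2"
    unfolding mem_S2_iff by blast
  have dim: "dim F \<le> 2" if F: "\<And>v. v \<in> F \<Longrightarrow> \<exists>s t. v = s *\<^sub>R x + t *\<^sub>R y" for F and x y :: "real ^ 'n"
  proof -
    have "F \<subseteq> span {x, y}"
    proof
      fix v assume "v \<in> F"
      then obtain s t where "v = s *\<^sub>R x + t *\<^sub>R y" using F by blast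
      then show "v \<in> span {x, y}" by (simp add: span_add span_mul span_base)
    qed
    then have "dim F \<le> card {x, y}" by (intro dim_le_card) auto
    also have "\<dots> \<le> 2" by (simp add: card_insert_if)
    finally show ?thesis .
  qed
  have "dim {(\<chi> i. Y $ i $ j $ k) | j k. True} \<le> 2"
  proof (rule dim)
    fix v assume "v \<in> {(\<chi> i. Y $ i $ j $ k) | j k. True}"
    then obtain j k where v: "v = (\<chi> i. Y $ i $ j $ k)" by blast
    show "\<exists>s t. v = s *\<^sub>R a1 + t *\<^sub>R a2"
      by (rule exI[of _ "b1 $ j * c1 $ k"], rule exI[of _ "b2 $ j * c2 $ k"]) (simp add: v Y vec_eq_iff)
  qed
  moreover have "dim {(\<chi> j. Y $ i $ j $ k) | i k. True} \<le> 2"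
  proof (rule dim)
    fix v assume "v \<in> {(\<chi> j. Y $ i $ j $ k) | i k. True}"
    then obtain i k where v: "v = (\<chi> j. Y $ i $ j $ k)" by blast
    show "\<exists>s t. v = s *\<^sub>R b1 + t *\<^sub>R b2"
      by (rule exI[of _ "a1 $ i * c1 $ k"], rule exI[of _ "a2 $ i * c2 $ k"]) (simp add: v Y vec_eq_iff)
  qed
  moreover have "dim {(\<chi> k. Y $ i $ j $ k) | i j. True} \<le> 2"
  proof (rule dim)
    fix v assume "v \<in> {(\<chi> k. Y $ i $ j $ k) | i j. True}"
    then obtain i j where v: "v = (\<chi> k. Y $ i $ j $ k)" by blast
    show "\<exists>s t. v = s *\<^sub>R c1 + t *\<^sub>R c2"
      by (rule exI[of _ "a1 $ i * b1 $ j"], rule exI[of _ "a2 $ i * b2 $ j"]) (simp add: v Y vec_eq_iff)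
  qed
  ultimately show "Y \<in> M222" by (simp add: M222_def mrank_def)
qed

section \<open>Best approximations that are flat in the third mode\<close>

lemma best_rank2_approx_flat_first_order:
  assumes best: "best_rank2_approx Z (outer a1 b1 c + outer a2 b2 c)"
  defines "R \<equiv> Z - (outer a1 b1 c + outer a2 b2 c)"
  shows "R \<bullet> outer a1 v c = 0" "R \<bullet> outer a2 v c = 0"
    and "R \<bullet> outer u b1 c = 0" "R \<bullet> outer u b2 c = 0"
    and "R \<bullet> outer a1 b1 w = 0" "R \<bullet> outer a1 b2 w = 0" "R \<bullet> outer a2 b1 w = 0" "R \<bullet> outer a2 b2 w = 0"
proof -
  let ?Y = "outer a1 b1 c + outer a2 b2 c"
  have line: "R \<bullet> D = 0" if "\<And>t. \<exists>x y z x' y' z'. ?Y + t *\<^sub>R D = outer x y z + outer x' y' z'" for D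
    unfolding R_def by (rule best_rank2_approx_first_order[OF best]) (use that mem_S2_iff in blast)
  have "?Y + t *\<^sub>R outer a1 v c = outer a1 (b1 + t *\<^sub>R v) c + outer a2 b2 c" for t
    by (simp add: scaleR_outer(2) outer_add2)
  then show "R \<bullet> outer a1 v c = 0" by (intro line) metis
  have "?Y + t *\<^sub>R outer a2 v c = outer a1 b1 c + outer a2 (b2 + t *\<^sub>R v) c" for t
    by (simp add: scaleR_outer(2) outer_add2)
  then show "R \<bullet> outer a2 v c = 0" by (intro line) metis
  have "?Y + t *\<^sub>R outer u b1 c = outer (a1 + t *\<^sub>R u) b1 c + outer a2 b2 c" for t
    by (simp add: scaleR_outer(3) outer_add1)
  then show "R \<bullet> outer u b1 c = 0" by (intro line) metis
  have "?Y + t *\<^sub>R outer u b2 c = outer a1 b1 c + outer (a2 + t *\<^sub>R u) b2 c" for t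
    by (simp add: scaleR_outer(3) outer_add1)
  then show "R \<bullet> outer u b2 c = 0" by (intro line) metis
  have "?Y + t *\<^sub>R outer a1 b1 w = outer a1 b1 (c + t *\<^sub>R w) + outer a2 b2 c" for t
    by (simp add: scaleR_outer(1) outer_add3)
  then show 1: "R \<bullet> outer a1 b1 w = 0" by (intro line) metis
  have "?Y + t *\<^sub>R outer a2 b2 w = outer a1 b1 c + outer a2 b2 (c + t *\<^sub>R w)" for t
    by (simp add: scaleR_outer(1) outer_add3)
  then show 2: "R \<bullet> outer a2 b2 w = 0" by (intro line) metis
  \<comment> \<open>The mixed conditions come from a second decomposition of \<open>?Y\<close>: with
    \<open>c\<close> common to both terms, \<open>outer a1 b2 c\<close> may be moved from one
    summand to the other.\<close>
  have "?Y + t *\<^sub>R outer a1 (b1 - b2) w = outer a1 (b1 - b2) (c + t *\<^sub>R w) + outer (a2 + a1) b2 c" for t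
    by (simp add: scaleR_outer(1) outer_add3 outer_add1 outer_diff2 scaleR_right_diff_distrib)
  then have "R \<bullet> outer a1 (b1 - b2) w = 0" by (intro line) metis
  then show "R \<bullet> outer a1 b2 w = 0" using 1 by (simp add: outer_diff2 inner_diff_right)
  have "?Y + t *\<^sub>R outer a2 (b2 - b1) w = outer a2 (b2 - b1) (c + t *\<^sub>R w) + outer (a1 + a2) b1 c" for t
    by (simp add: scaleR_outer(1) outer_add3 outer_add1 outer_diff2 scaleR_right_diff_distrib)
  then have "R \<bullet> outer a2 (b2 - b1) w = 0" by (intro line) metis
  then show "R \<bullet> outer a2 b1 w = 0" using 2 by (simp add: outer_diff2 inner_diff_right)
qed

section \<open>A polynomial chart for the flat critical pairs\<close>

lemma indep2_normalized_basis:
  fixes a1 a2 :: "real ^ 'n"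
  assumes "indep2 a1 a2"
  obtains \<iota> :: "bool \<Rightarrow> 'n" and p \<alpha> \<beta> where "\<iota> False \<noteq> \<iota> True" "\<And>r r'. p r $ \<iota> r' = of_bool (r = r')"
    "\<And>r. p r = \<alpha> r *\<^sub>R a1 + \<beta> r *\<^sub>R a2"
    "a1 = (\<Sum>r\<in>UNIV. a1 $ \<iota> r *\<^sub>R p r)" "a2 = (\<Sum>r\<in>UNIV. a2 $ \<iota> r *\<^sub>R p r)"
proof -
  obtain i0 i1 where d: "a1 $ i0 * a2 $ i1 \<noteq> a1 $ i1 * a2 $ i0"
    using assms by (auto simp: indep2_def)
  let ?d = "a1 $ i0 * a2 $ i1 - a1 $ i1 * a2 $ i0"
  define \<iota> where "\<iota> = (\<lambda>r. if r then i1 else i0)"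
  define e where "e = 1 / ?d"
  \<comment> \<open>\<open>\<alpha>\<close> and \<open>\<beta>\<close> form the inverse of the
    matrix of entries of \<open>a1\<close>, \<open>a2\<close> at \<open>i0\<close>,
    \<open>i1\<close>.\<close>
  define \<alpha> where "\<alpha> = (\<lambda>r. if r then - (e * a2 $ i0) else e * a2 $ i1)"
  define \<beta> where "\<beta> = (\<lambda>r. if r then e * a1 $ i0 else - (e * a1 $ i1))"
  define p where "p = (\<lambda>r. \<alpha> r *\<^sub>R a1 + \<beta> r *\<^sub>R a2)"
  have e: "e * (a1 $ i0 * a2 $ i1) = 1 + e * (a1 $ i1 * a2 $ i0)"
    using d by (simp add: e_def field_simps)
  have ab: "a1 $ i0 * \<alpha> False + a1 $ i1 * \<alpha> True = 1" "a1 $ i0 * \<beta> False + a1 $ i1 * \<beta> True = 0"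
    "a2 $ i0 * \<alpha> False + a2 $ i1 * \<alpha> True = 0" "a2 $ i0 * \<beta> False + a2 $ i1 * \<beta> True = 1"
    using e by (simp_all add: \<alpha>_def \<beta>_def algebra_simps)
  have inj: "\<iota> False \<noteq> \<iota> True" using d by (auto simp: \<iota>_def)
  have p: "p r $ \<iota> r' = of_bool (r = r')" for r r'
    using e by (cases r; cases r') (simp_all add: p_def \<alpha>_def \<beta>_def \<iota>_def algebra_simps)
  have expand: "v = (\<Sum>r\<in>UNIV. v $ \<iota> r *\<^sub>R p r)"
    if "v $ i0 * \<alpha> False + v $ i1 * \<alpha> True = s" "v $ i0 * \<beta> False + v $ i1 * \<beta> True = t" "v = s *\<^sub>R a1 + t *\<^sub>R a2" for v s t
  proof -
    have "(\<Sum>r\<in>UNIV. v $ \<iota> r *\<^sub>R p r) = (v $ i0 * \<alpha> False + v $ i1 * \<alpha> True) *\<^sub>R a1 + (v $ i0 * \<beta> False + v $ i1 * \<beta> True) *\<^sub>R a2"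
      by (simp add: UNIV_bool \<iota>_def p_def algebra_simps)
    then show ?thesis using that by metis
  qed
  have a1: "a1 = (\<Sum>r\<in>UNIV. a1 $ \<iota> r *\<^sub>R p r)"
    by (rule expand[OF ab(1,2)]) simp
  have a2: "a2 = (\<Sum>r\<in>UNIV. a2 $ \<iota> r *\<^sub>R p r)"
    by (rule expand[OF ab(3,4)]) simp
  show ?thesis
    by (rule that[of \<iota> p \<alpha> \<beta>]) (fact inj, fact p, simp add: p_def, fact a1, fact a2)
qed

text \<open>
  The parameters of \<open>(Y, R)\<close> are stored in the coordinates of a single tensor \<open>T\<close>.  The distinguished
  rows are \<open>\<iota> r\<close>, the distinguished columns \<open>\<kappa> s\<close>, and the distinguished slice is \<open>k0\<close>.  In slice \<open>k0\<close>,
  \<open>T\<close> stores the block of \<open>A\<close> in the distinguished rows and columns, the bases \<open>p\<close> of \<open>U\<close> and \<open>q\<close> of \<open>V\<close>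
  normalized to be the identity there, and elsewhere the contraction of \<open>R\<close> with \<open>c\<close>.  The other
  slices store those of \<open>R\<close>, except that the entry at \<open>(\<iota> False, \<kappa> False)\<close> is used for \<open>c\<close>, normalized
  to be 1 at \<open>k0\<close>.  Orthogonality to \<open>U \<otimes> V \<otimes> w\<close> determines the block entries of \<open>R\<close> from the others,
  so the three remaining block entries of \<open>T\<close> do not influence the result, and \<open>T\<close> may be restricted to
  a hyperplane.
\<close>

definition chart_p :: "(bool \<Rightarrow> 'i) \<Rightarrow> (bool \<Rightarrow> 'j) \<Rightarrow> 'k \<Rightarrow> ('i::finite, 'j::finite, 'k::finite) tensor \<Rightarrow> bool \<Rightarrow> 'i \<Rightarrow> real"
  where "chart_p \<iota> \<kappa> k0 T r i =
    (if i = \<iota> True then of_bool r else if i = \<iota> False then of_bool (\<not> r) else T $ i $ \<kappa> r $ k0)"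

definition chart_q :: "(bool \<Rightarrow> 'i) \<Rightarrow> (bool \<Rightarrow> 'j) \<Rightarrow> 'k \<Rightarrow> ('i::finite, 'j::finite, 'k::finite) tensor \<Rightarrow> bool \<Rightarrow> 'j \<Rightarrow> real"
  where "chart_q \<iota> \<kappa> k0 T s j =
    (if j = \<kappa> True then of_bool s else if j = \<kappa> False then of_bool (\<not> s) else T $ \<iota> s $ j $ k0)"

definition chart_c :: "(bool \<Rightarrow> 'i) \<Rightarrow> (bool \<Rightarrow> 'j) \<Rightarrow> 'k \<Rightarrow> ('i::finite, 'j::finite, 'k::finite) tensor \<Rightarrow> 'k \<Rightarrow> real"
  where "chart_c \<iota> \<kappa> k0 T k = (if k = k0 then 1 else T $ \<iota> False $ \<kappa> False $ k)"

text \<open>The matrix of the projection onto the orthogonal complement of the span of the \<open>p r\<close>, along the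
  unit vectors at the \<open>\<iota> r\<close>.\<close>

definition compl_proj :: "(bool \<Rightarrow> 'n) \<Rightarrow> (bool \<Rightarrow> 'n \<Rightarrow> real) \<Rightarrow> 'n \<Rightarrow> 'n \<Rightarrow> real"
  where "compl_proj \<iota> p i l = of_bool (i = l) - (\<Sum>r\<in>UNIV. of_bool (i = \<iota> r) * p r l)"

text \<open>For normalized \<open>p\<close> and \<open>q\<close>, this changes only the block
  entries of each slice, so that its contractions with \<open>p r\<close> and \<open>q s\<close>
  vanish.\<close>

definition block_proj :: "(bool \<Rightarrow> 'i) \<Rightarrow> (bool \<Rightarrow> 'j) \<Rightarrow> (bool \<Rightarrow> 'i \<Rightarrow> real) \<Rightarrow> (bool \<Rightarrow> 'j \<Rightarrow> real) \<Rightarrow>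
    ('i::finite, 'j::finite, 'k::finite) tensor \<Rightarrow> 'i \<Rightarrow> 'j \<Rightarrow> 'k \<Rightarrow> real"
  where "block_proj \<iota> \<kappa> p q T i j k = T $ i $ j $ k
    - (\<Sum>r\<in>UNIV. \<Sum>s\<in>UNIV. of_bool (i = \<iota> r \<and> j = \<kappa> s) * (\<Sum>l\<in>UNIV. \<Sum>m\<in>UNIV. p r l * q s m * T $ l $ m $ k))"

text \<open>The first summand is \<open>Y\<close>, the second is \<open>R\<close>. As
  \<open>c\<close> is 1 at \<open>k0\<close>, slice \<open>k0\<close> of \<open>R\<close> is its
  contraction with \<open>c\<close> minus the weighted other slices.\<close>

definition flat_chart :: "(bool \<Rightarrow> 'i) \<Rightarrow> (bool \<Rightarrow> 'j) \<Rightarrow> 'k \<Rightarrow> ('i::finite, 'j::finite, 'k::finite) tensor \<Rightarrow> ('i, 'j, 'k) tensor"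
  where "flat_chart \<iota> \<kappa> k0 T = (let p = chart_p \<iota> \<kappa> k0 T; q = chart_q \<iota> \<kappa> k0 T; c = chart_c \<iota> \<kappa> k0 T in
    (\<chi> i j k. (\<Sum>r\<in>UNIV. \<Sum>s\<in>UNIV. p r i * q s j * T $ \<iota> r $ \<kappa> s $ k0) * c k
      + (if k = k0 then (\<Sum>l\<in>UNIV. \<Sum>m\<in>UNIV. compl_proj \<iota> p i l * compl_proj \<kappa> q j m * T $ l $ m $ k0)
            - (\<Sum>k'\<in>UNIV-{k0}. c k' * block_proj \<iota> \<kappa> p q T i j k')
         else block_proj \<iota> \<kappa> p q T i j k)))"

lemma real_polynomial_function_nth: "real_polynomial_function (\<lambda>T :: ('i::finite, 'j::finite, 'k::finite) tensor. T $ i $ j $ k)"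
  by (intro real_polynomial_function.intros(1) bounded_linear_compose[OF bounded_linear_vec_nth] bounded_linear_vec_nth)

lemma polynomial_function_flat_chart: "polynomial_function (flat_chart \<iota> \<kappa> k0 :: ('i::finite, 'j::finite, 'k::finite) tensor \<Rightarrow> _)"
proof -
  note n = real_polynomial_function_nth real_polynomial_function.intros(2-4) real_polynomial_function_diff real_polynomial_function_sum finite
  have p: "real_polynomial_function (\<lambda>T :: ('i, 'j, 'k) tensor. chart_p \<iota> \<kappa> k0 T r i)" for r i
    unfolding chart_p_def by (cases "i = \<iota> True"; cases "i = \<iota> False") (auto intro: n)
  have q: "real_polynomial_function (\<lambda>T :: ('i, 'j, 'k) tensor. chart_q \<iota> \<kappa> k0 T r i)" for r i
    unfolding chart_q_def by (cases "i = \<kappa> True"; cases "i = \<kappa> False") (auto intro: n)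
  have c: "real_polynomial_function (\<lambda>T :: ('i, 'j, 'k) tensor. chart_c \<iota> \<kappa> k0 T k)" for k
    unfolding chart_c_def by (cases "k = k0") (auto intro: n)
  have b: "real_polynomial_function (\<lambda>T :: ('i, 'j, 'k) tensor. block_proj \<iota> \<kappa> (chart_p \<iota> \<kappa> k0 T) (chart_q \<iota> \<kappa> k0 T) T i j k)" for i j k
    unfolding block_proj_def by (intro n p q)
  have "real_polynomial_function (\<lambda>T :: ('i, 'j, 'k) tensor. flat_chart \<iota> \<kappa> k0 T $ i $ j $ k)" for i j k
    unfolding flat_chart_def Let_def compl_proj_def vec_lambda_beta
    by (cases "k = k0"; simp only: simp_thms if_True if_False; intro n p q c b)
  then show ?thesis
    by (auto simp: polynomial_function_iff_Basis_inner Basis_vec_def inner_axis)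
qed

text \<open>A differentiable map between spaces of equal dimension sends null sets to null
  sets.\<close>

lemma negligible_flat_chart_hyperplane:
  fixes \<iota> :: "bool \<Rightarrow> 'i::finite" and \<kappa> :: "bool \<Rightarrow> 'j::finite" and k0 :: "'k::finite"
  shows "negligible (flat_chart \<iota> \<kappa> k0 ` {T. T $ i $ j $ k = 0})"
proof (rule negligible_differentiable_image_negligible)
  have "axis i (axis j (axis k 1)) \<in> (Basis :: ('i, 'j, 'k) tensor set)"
    by (auto simp: Basis_vec_def)
  from negligible_standard_hyperplane[OF this, of 0]
  show "negligible {T :: ('i, 'j, 'k) tensor. T $ i $ j $ k = 0}"
    by (simp add: inner_axis)
qed (auto intro: differentiable_on_polynomial_function polynomial_function_flat_chart)

lemma sum_UNIV_single:
  fixes f :: "'a::finite \<Rightarrow> 'b::comm_monoid_add"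
  assumes "\<And>l. l \<noteq> a \<Longrightarrow> f l = 0"
  shows "sum f UNIV = f a"
  using assms by (subst sum.remove[of _ a]) auto

lemma block_sum:
  fixes p :: "bool \<Rightarrow> 'i::finite \<Rightarrow> real" and q :: "bool \<Rightarrow> 'j::finite \<Rightarrow> real"
  assumes p: "\<And>r r'. p r (\<iota> r') = of_bool (r = r')" and q: "\<And>s s'. q s (\<kappa> s') = of_bool (s = s')"
    and X: "\<And>l m. l \<notin> range \<iota> \<or> m \<notin> range \<kappa> \<Longrightarrow> X l m = 0"
  shows "(\<Sum>l\<in>UNIV. \<Sum>m\<in>UNIV. p r l * q s m * X l m) = X (\<iota> r) (\<kappa> s)"
proof -
  have "(\<Sum>l\<in>UNIV. \<Sum>m\<in>UNIV. p r l * q s m * X l m) = (\<Sum>m\<in>UNIV. p r (\<iota> r) * q s m * X (\<iota> r) m)"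
  proof (rule sum_UNIV_single)
    fix l assume "l \<noteq> \<iota> r"
    then have "p r l * q s m * X l m = 0" for m
      using p X[of l m] by (cases "l \<in> range \<iota>") auto
    then show "(\<Sum>m\<in>UNIV. p r l * q s m * X l m) = 0" by (intro sum.neutral ballI)
  qed
  also have "\<dots> = p r (\<iota> r) * q s (\<kappa> s) * X (\<iota> r) (\<kappa> s)"
  proof (rule sum_UNIV_single)
    fix m assume "m \<noteq> \<kappa> s"
    have "q s m = 0 \<or> X (\<iota> r) m = 0"
    proof (cases "m \<in> range \<kappa>")
      case True
      then obtain s' where s': "m = \<kappa> s'" by blast
      with \<open>m \<noteq> \<kappa> s\<close> have "s' \<noteq> s" by blast
      then show ?thesis using q[of s s'] by (auto simp: s')
    qed (simp add: X)
    then show "p r (\<iota> r) * q s m * X (\<iota> r) m = 0" by auto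
  qed
  finally show ?thesis by (simp add: p q)
qed

text \<open>Hence entries of \<open>T\<close> in the distinguished rows or columns do not enter the
  contraction recovered from slice \<open>k0\<close>.\<close>

lemma compl_proj_block_eq_0:
  assumes p: "\<And>r r'. p r (\<iota> r') = of_bool (r = r')"
  shows "compl_proj \<iota> p i (\<iota> r) = 0"
proof -
  have "(\<Sum>r'\<in>UNIV. of_bool (i = \<iota> r') * p r' (\<iota> r)) = of_bool (i = \<iota> r)"
    by (subst sum_UNIV_single[of r]) (simp_all add: p)
  then show ?thesis by (simp add: compl_proj_def del: sum_of_bool_mult_eq sum_mult_of_bool_eq)
qed

lemma compl_proj_sum:
  fixes p :: "bool \<Rightarrow> 'i::finite \<Rightarrow> real"
  assumes "\<And>r. (\<Sum>l\<in>UNIV. p r l * x l) = 0"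
  shows "(\<Sum>l\<in>UNIV. compl_proj \<iota> p i l * x l) = x i"
proof -
  have "(\<Sum>l\<in>UNIV. of_bool (i = l) * x l) = x i"
    by (subst sum_UNIV_single[of i]) auto
  then have "(\<Sum>l\<in>UNIV. compl_proj \<iota> p i l * x l)
      = x i - (\<Sum>l\<in>UNIV. \<Sum>r\<in>UNIV. of_bool (i = \<iota> r) * (p r l * x l))"
    by (simp add: compl_proj_def left_diff_distrib sum_subtractf sum_distrib_right mult.assoc del: sum_of_bool_mult_eq)
  also have "(\<Sum>l\<in>UNIV. \<Sum>r\<in>UNIV. of_bool (i = \<iota> r) * (p r l * x l))
      = (\<Sum>r\<in>UNIV. of_bool (i = \<iota> r) * (\<Sum>l\<in>UNIV. p r l * x l))"
    by (subst sum.swap) (simp add: sum_distrib_left)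
  finally show ?thesis by (simp add: assms)
qed

lemma flat_chart_surj:
  fixes R :: "('i::finite, 'j::finite, 'k::finite) tensor"
    and p :: "bool \<Rightarrow> 'i \<Rightarrow> real" and q :: "bool \<Rightarrow> 'j \<Rightarrow> real" and c :: "'k \<Rightarrow> real"
  assumes \<iota>: "\<iota> False \<noteq> \<iota> True" and \<kappa>: "\<kappa> False \<noteq> \<kappa> True"
    and p: "\<And>r r'. p r (\<iota> r') = of_bool (r = r')" and q: "\<And>s s'. q s (\<kappa> s') = of_bool (s = s')"
    and c: "c k0 = 1" and k1: "k1 \<noteq> k0"
    and R_block: "\<And>r s k. (\<Sum>l\<in>UNIV. \<Sum>m\<in>UNIV. p r l * q s m * R $ l $ m $ k) = 0"
    and R_p: "\<And>r m. (\<Sum>l\<in>UNIV. p r l * (\<Sum>k\<in>UNIV. c k * R $ l $ m $ k)) = 0"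
    and R_q: "\<And>s l. (\<Sum>m\<in>UNIV. q s m * (\<Sum>k\<in>UNIV. c k * R $ l $ m $ k)) = 0"
  shows "(\<chi> i j k. (\<Sum>r\<in>UNIV. \<Sum>s\<in>UNIV. p r i * q s j * G r s) * c k + R $ i $ j $ k)
    \<in> flat_chart \<iota> \<kappa> k0 ` {T. T $ \<iota> False $ \<kappa> True $ k1 = 0}"
proof -
  define B where "B = (\<lambda>l m. \<Sum>k\<in>UNIV. c k * R $ l $ m $ k)"
  \<comment> \<open>The parameters go to their storage places. The entry set to 0 lies in the block
    of slice \<open>k1\<close>, where \<open>block_proj\<close> discards it.\<close>
  define T :: "('i, 'j, 'k) tensor" where "T = (\<chi> i j k.
    if k = k0 then
      (if i \<in> range \<iota> then (if j \<in> range \<kappa> then G (i = \<iota> True) (j = \<kappa> True) else q (i = \<iota> True) j)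
       else if j \<in> range \<kappa> then p (j = \<kappa> True) i else B i j)
    else if i = \<iota> False \<and> j = \<kappa> False then c k
    else if i = \<iota> False \<and> j = \<kappa> True \<and> k = k1 then 0 else R $ i $ j $ k)"
  have [simp]: "\<iota> r = \<iota> r' \<longleftrightarrow> r = r'" for r r' using \<iota> by (cases r; cases r') auto
  have [simp]: "\<kappa> r = \<kappa> r' \<longleftrightarrow> r = r'" for r r' using \<kappa> by (cases r; cases r') auto
  have nr: "i \<notin> range \<iota> \<longleftrightarrow> i \<noteq> \<iota> False \<and> i \<noteq> \<iota> True" for i by (auto simp: UNIV_bool)
  have nr': "j \<notin> range \<kappa> \<longleftrightarrow> j \<noteq> \<kappa> False \<and> j \<noteq> \<kappa> True" for j by (auto simp: UNIV_bool)
  have Tp: "chart_p \<iota> \<kappa> k0 T = p"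
  proof (intro ext)
    fix r i show "chart_p \<iota> \<kappa> k0 T r i = p r i"
      using nr[of i] by (cases "i \<in> range \<iota>") (auto simp: chart_p_def T_def p)
  qed
  have Tq: "chart_q \<iota> \<kappa> k0 T = q"
  proof (intro ext)
    fix s j show "chart_q \<iota> \<kappa> k0 T s j = q s j"
      using nr'[of j] by (cases "j \<in> range \<kappa>") (auto simp: chart_q_def T_def q)
  qed
  have Tc: "chart_c \<iota> \<kappa> k0 T = c"
    by (auto simp: chart_c_def T_def c)
  have TG: "T $ \<iota> r $ \<kappa> s $ k0 = G r s" for r s
    by (simp add: T_def)
  have Tblock: "block_proj \<iota> \<kappa> p q T i j k = R $ i $ j $ k" if k: "k \<noteq> k0" for i j k
  proof -
    \<comment> \<open>The error of \<open>T\<close> in this slice is supported on the block. Since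
      \<open>R\<close> contracts to 0, the contractions of \<open>T\<close> read off exactly this
      error, which \<open>block_proj\<close> subtracts.\<close>
    define X where "X = (\<lambda>l m. T $ l $ m $ k - R $ l $ m $ k)"
    have X: "X l m = 0" if "l \<notin> range \<iota> \<or> m \<notin> range \<kappa>" for l m
      using that k by (auto simp: X_def T_def)
    have "(\<Sum>l\<in>UNIV. \<Sum>m\<in>UNIV. p r l * q s m * T $ l $ m $ k) = X (\<iota> r) (\<kappa> s)" for r s
    proof -
      have "(\<Sum>l\<in>UNIV. \<Sum>m\<in>UNIV. p r l * q s m * T $ l $ m $ k)
        = (\<Sum>l\<in>UNIV. \<Sum>m\<in>UNIV. p r l * q s m * X l m) + (\<Sum>l\<in>UNIV. \<Sum>m\<in>UNIV. p r l * q s m * R $ l $ m $ k)"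
        by (simp add: X_def right_diff_distrib sum_subtractf)
      then show ?thesis
        using R_block block_sum[of p \<iota> q \<kappa> X, OF p q X] by simp
    qed
    then have "block_proj \<iota> \<kappa> p q T i j k
        = T $ i $ j $ k - (\<Sum>r\<in>UNIV. \<Sum>s\<in>UNIV. of_bool (i = \<iota> r \<and> j = \<kappa> s) * X (\<iota> r) (\<kappa> s))"
      by (simp add: block_proj_def)
    also have "(\<Sum>r\<in>UNIV. \<Sum>s\<in>UNIV. of_bool (i = \<iota> r \<and> j = \<kappa> s) * X (\<iota> r) (\<kappa> s)) = X i j"
      using X[of i j] nr[of i] nr'[of j]
      by (cases "i = \<iota> False"; cases "i = \<iota> True"; cases "j = \<kappa> False"; cases "j = \<kappa> True")
         (simp_all add: UNIV_bool del: sum_of_bool_mult_eq sum_mult_of_bool_eq)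
    finally show ?thesis by (simp add: X_def)
  qed
  have TB: "(\<Sum>l\<in>UNIV. \<Sum>m\<in>UNIV. compl_proj \<iota> p i l * compl_proj \<kappa> q j m * T $ l $ m $ k0) = B i j" for i j
  proof -
    \<comment> \<open>Where \<open>T\<close> and \<open>B\<close> may differ, a projection
      coefficient vanishes; the projections then fix \<open>B\<close> by \<open>R_p\<close> and
      \<open>R_q\<close>.\<close>
    have "compl_proj \<iota> p i l * compl_proj \<kappa> q j m * T $ l $ m $ k0 = compl_proj \<iota> p i l * (compl_proj \<kappa> q j m * B l m)" for l m
    proof (cases "l \<in> range \<iota> \<or> m \<in> range \<kappa>")
      case True
      then show ?thesis using compl_proj_block_eq_0[of p \<iota>, OF p] compl_proj_block_eq_0[of q \<kappa>, OF q] by auto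
    next
      case False
      then show ?thesis by (simp add: T_def)
    qed
    then have "(\<Sum>l\<in>UNIV. \<Sum>m\<in>UNIV. compl_proj \<iota> p i l * compl_proj \<kappa> q j m * T $ l $ m $ k0)
        = (\<Sum>l\<in>UNIV. compl_proj \<iota> p i l * (\<Sum>m\<in>UNIV. compl_proj \<kappa> q j m * B l m))"
      unfolding sum_distrib_left by (intro sum.cong refl)
    also have "\<dots> = B i j"
      by (simp add: compl_proj_sum R_p R_q B_def)
    finally show ?thesis .
  qed
  have Bk0: "B i j - (\<Sum>k\<in>UNIV-{k0}. c k * R $ i $ j $ k) = R $ i $ j $ k0" for i j
    unfolding B_def by (subst sum.remove[of UNIV k0]) (simp_all add: c)
  have "flat_chart \<iota> \<kappa> k0 T = (\<chi> i j k. (\<Sum>r\<in>UNIV. \<Sum>s\<in>UNIV. p r i * q s j * G r s) * c k + R $ i $ j $ k)"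
    unfolding flat_chart_def Let_def Tp Tq Tc TG TB
    by (simp add: vec_eq_iff Tblock Bk0)
  moreover have "T $ \<iota> False $ \<kappa> True $ k1 = 0"
    using k1 by (simp add: T_def)
  ultimately show ?thesis by (metis (mono_tags, lifting) image_eqI mem_Collect_eq)
qed

lemma negligible_flat_best_rank2_approx:
  assumes "CARD('k::finite) \<ge> 2"
  shows "negligible {Z :: ('i::finite, 'j::finite, 'k) tensor. \<exists>a1 a2 b1 b2 c.
    indep2 a1 a2 \<and> indep2 b1 b2 \<and> c \<noteq> 0 \<and> best_rank2_approx Z (outer a1 b1 c + outer a2 b2 c)}"
    (is "negligible ?B")
proof -
  \<comment> \<open>Finitely many charts, one for each choice of distinguished indices.\<close>
  let ?N = "\<Union>(\<iota>, \<kappa>, k0, k1) \<in> (UNIV :: ((bool \<Rightarrow> 'i) \<times> (bool \<Rightarrow> 'j) \<times> 'k \<times> 'k) set).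
    flat_chart \<iota> \<kappa> k0 ` {T. T $ \<iota> False $ \<kappa> True $ k1 = 0}"
  have "negligible ?N"
    by (rule negligible_Union) (auto intro: negligible_flat_chart_hyperplane)
  moreover have "?B \<subseteq> ?N"
  proof
    fix Z assume "Z \<in> ?B"
    then obtain a1 a2 b1 b2 c where a: "indep2 a1 a2" and b: "indep2 b1 b2" and c: "c \<noteq> 0"
      and best: "best_rank2_approx Z (outer a1 b1 c + outer a2 b2 c)" by auto
    obtain k0 where k0: "c $ k0 \<noteq> 0" using c by (auto simp: vec_eq_iff)
    have "UNIV \<noteq> {k0}" using assms by (auto dest: arg_cong[of _ _ card])
    then obtain k1 where k1: "k1 \<noteq> k0" by auto
    define R where "R = Z - (outer a1 b1 c + outer a2 b2 c)"
    note crit = best_rank2_approx_flat_first_order[OF best, folded R_def]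
    obtain \<iota> p \<alpha> \<beta> where \<iota>: "\<iota> False \<noteq> \<iota> True" and p: "\<And>r r'. p r $ \<iota> r' = of_bool (r = r')"
      and p_eq: "\<And>r. p r = \<alpha> r *\<^sub>R a1 + \<beta> r *\<^sub>R a2"
      and a_eq: "a1 = (\<Sum>r\<in>UNIV. a1 $ \<iota> r *\<^sub>R p r)" "a2 = (\<Sum>r\<in>UNIV. a2 $ \<iota> r *\<^sub>R p r)"
      by (rule indep2_normalized_basis[OF a]) (rule that)
    obtain \<kappa> q \<alpha>' \<beta>' where \<kappa>: "\<kappa> False \<noteq> \<kappa> True" and q: "\<And>r r'. q r $ \<kappa> r' = of_bool (r = r')"
      and q_eq: "\<And>r. q r = \<alpha>' r *\<^sub>R b1 + \<beta>' r *\<^sub>R b2"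
      and b_eq: "b1 = (\<Sum>r\<in>UNIV. b1 $ \<kappa> r *\<^sub>R q r)" "b2 = (\<Sum>r\<in>UNIV. b2 $ \<kappa> r *\<^sub>R q r)"
      by (rule indep2_normalized_basis[OF b]) (rule that)
    \<comment> \<open>\<open>c\<close> is rescaled to be 1 at \<open>k0\<close>; the factor moves
      into \<open>G\<close>, the coefficients of the matrix in the bases \<open>p\<close> and
      \<open>q\<close>.\<close>
    define d where "d = (1 / c $ k0) *\<^sub>R c"
    define G where "G = (\<lambda>r s. c $ k0 * (a1 $ \<iota> r * b1 $ \<kappa> s + a2 $ \<iota> r * b2 $ \<kappa> s))"
    have lin: "R \<bullet> outer (p r) v c = 0" "R \<bullet> outer u (q s) c = 0" "R \<bullet> outer (p r) (q s) w = 0" for r s u v w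
      by (simp_all add: p_eq q_eq outer_add1 outer_add2 inner_add_right crit flip: scaleR_outer(2,3))
    have "(\<Sum>l\<in>UNIV. \<Sum>m\<in>UNIV. p r $ l * q s $ m * R $ l $ m $ k) = 0" for r s k
    proof -
      have "R \<bullet> outer (p r) (q s) (axis k 1) = (\<Sum>l\<in>UNIV. \<Sum>m\<in>UNIV. p r $ l * q s $ m * R $ l $ m $ k)"
        unfolding inner_outer
        by (intro sum.cong refl, subst sum_UNIV_single[of k]) (auto simp: axis_def)
      then show ?thesis using lin(3)[of r s "axis k 1"] by simp
    qed
    moreover have "(\<Sum>l\<in>UNIV. p r $ l * (\<Sum>k\<in>UNIV. d $ k * R $ l $ m $ k)) = 0" for r m
    proof -
      have "R \<bullet> outer (p r) (axis m 1) d = 0"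
        using lin(1)[of r "axis m 1"] by (simp add: d_def flip: scaleR_outer(1))
      also have "R \<bullet> outer (p r) (axis m 1) d = (\<Sum>l\<in>UNIV. p r $ l * (\<Sum>k\<in>UNIV. d $ k * R $ l $ m $ k))"
        unfolding inner_outer
        by (intro sum.cong refl, subst sum_UNIV_single[of m]) (auto simp: axis_def sum_distrib_left mult_ac)
      finally show ?thesis .
    qed
    moreover have "(\<Sum>m\<in>UNIV. q s $ m * (\<Sum>k\<in>UNIV. d $ k * R $ l $ m $ k)) = 0" for s l
    proof -
      have "R \<bullet> outer (axis l 1) (q s) d = 0"
        using lin(2)[of "axis l 1" s] by (simp add: d_def flip: scaleR_outer(1))
      also have "R \<bullet> outer (axis l 1) (q s) d = (\<Sum>m\<in>UNIV. q s $ m * (\<Sum>k\<in>UNIV. d $ k * R $ l $ m $ k))"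
        unfolding inner_outer
        by (subst sum_UNIV_single[of l]) (auto simp: axis_def sum_distrib_left mult_ac)
      finally show ?thesis .
    qed
    moreover have "d $ k0 = 1" using k0 by (simp add: d_def)
    ultimately have "(\<chi> i j k. (\<Sum>r\<in>UNIV. \<Sum>s\<in>UNIV. p r $ i * q s $ j * G r s) * d $ k + R $ i $ j $ k)
      \<in> flat_chart \<iota> \<kappa> k0 ` {T. T $ \<iota> False $ \<kappa> True $ k1 = 0}"
      using flat_chart_surj[of \<iota> \<kappa> "\<lambda>r i. p r $ i" "\<lambda>r i. q r $ i" "\<lambda>k. d $ k" k0 k1 R G] \<iota> \<kappa> p q k1 by blast
    moreover have "(\<chi> i j k. (\<Sum>r\<in>UNIV. \<Sum>s\<in>UNIV. p r $ i * q s $ j * G r s) * d $ k + R $ i $ j $ k) = Z"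
      unfolding vec_eq_iff
    proof (intro allI)
      fix i j k
      have "a1 $ i = (\<Sum>r\<in>UNIV. a1 $ \<iota> r * p r $ i)" "a2 $ i = (\<Sum>r\<in>UNIV. a2 $ \<iota> r * p r $ i)"
        by (subst a_eq, simp)+
      moreover have "b1 $ j = (\<Sum>r\<in>UNIV. b1 $ \<kappa> r * q r $ j)" "b2 $ j = (\<Sum>r\<in>UNIV. b2 $ \<kappa> r * q r $ j)"
        by (subst b_eq, simp)+
      ultimately have "(\<Sum>r\<in>UNIV. \<Sum>s\<in>UNIV. p r $ i * q s $ j * G r s) = c $ k0 * (a1 $ i * b1 $ j + a2 $ i * b2 $ j)"
        by (simp add: G_def UNIV_bool algebra_simps)
      then show "(\<chi> i j k. (\<Sum>r\<in>UNIV. \<Sum>s\<in>UNIV. p r $ i * q s $ j * G r s) * d $ k + R $ i $ j $ k) $ i $ j $ k = Z $ i $ j $ k"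
        using k0 by (simp add: d_def R_def field_simps)
    qed
    ultimately have "Z \<in> flat_chart \<iota> \<kappa> k0 ` {T. T $ \<iota> False $ \<kappa> True $ k1 = 0}" by metis
    then show "Z \<in> ?N" by (intro UN_I[of "(\<iota>, \<kappa>, k0, k1)"]) simp_all
  qed
  ultimately show ?thesis by (rule negligible_subset)
qed

section \<open>Permuting the modes\<close>

text \<open>Iterating the cyclic shift brings any mode to the third place.\<close>

definition cyc :: "('i::finite, 'j::finite, 'k::finite) tensor \<Rightarrow> ('j, 'k, 'i) tensor"
  where "cyc X = (\<chi> j k i. X $ i $ j $ k)"

lemma cyc_cyc_cyc: "cyc (cyc (cyc X)) = X"
  by (simp add: cyc_def vec_eq_iff)

lemma cyc_outer: "cyc (outer a b c) = outer b c a"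
  by (simp add: cyc_def vec_eq_iff)

lemma cyc_add: "cyc (X + Y) = cyc X + cyc Y"
  by (simp add: cyc_def vec_eq_iff)

lemma cyc_diff: "cyc (X - Y) = cyc X - cyc Y"
  by (simp add: cyc_def vec_eq_iff)

lemma bounded_linear_cyc: "bounded_linear (cyc :: ('i::finite, 'j::finite, 'k::finite) tensor \<Rightarrow> _)"
  unfolding linear_conv_bounded_linear[symmetric]
  by (auto intro!: linearI simp: cyc_def vec_eq_iff)

lemma norm_cyc: "(norm (cyc X))\<^sup>2 = (norm X)\<^sup>2"
proof -
  have "(norm (cyc X))\<^sup>2 = (\<Sum>j\<in>UNIV. \<Sum>k\<in>UNIV. \<Sum>i\<in>UNIV. (X $ i $ j $ k)\<^sup>2)"
    by (simp add: norm_tensor_power2 cyc_def)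
  also have "\<dots> = (\<Sum>j\<in>UNIV. \<Sum>i\<in>UNIV. \<Sum>k\<in>UNIV. (X $ i $ j $ k)\<^sup>2)"
    by (intro sum.cong refl) (rule sum.swap)
  also have "\<dots> = (norm X)\<^sup>2"
    unfolding norm_tensor_power2 by (rule sum.swap)
  finally show ?thesis .
qed

lemma cyc_S2: "X \<in> S2 \<Longrightarrow> cyc X \<in> S2"
  unfolding mem_S2_iff by (elim exE) (simp only: cyc_add cyc_outer, intro exI, rule refl)

lemma best_rank2_approx_cyc:
  fixes Z X :: "('i::finite, 'j::finite, 'k::finite) tensor"
  assumes "best_rank2_approx Z X"
  shows "best_rank2_approx (cyc Z) (cyc X)"
  unfolding best_rank2_approx_def
proof (intro conjI ballI)
  show "cyc X \<in> S2" using assms by (simp add: best_rank2_approx_def cyc_S2)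
  fix Y :: "('j, 'k, 'i) tensor" assume "Y \<in> S2"
  then have "cyc (cyc Y) \<in> S2" by (intro cyc_S2)
  then have "(norm (Z - X))\<^sup>2 \<le> (norm (Z - cyc (cyc Y)))\<^sup>2"
    using assms by (simp add: best_rank2_approx_def)
  also have "\<dots> = (norm (cyc Z - Y))\<^sup>2"
    using norm_cyc[of "Z - cyc (cyc Y)"] by (simp add: cyc_diff cyc_cyc_cyc)
  finally show "(norm (cyc Z - cyc X))\<^sup>2 \<le> (norm (cyc Z - Y))\<^sup>2"
    by (simp add: norm_cyc flip: cyc_diff)
qed

text \<open>The preimage is the image under the inverse of \<open>cyc\<close>, which is
  \<open>cyc\<close> applied twice.\<close>

lemma negligible_cyc_vimage:
  fixes B :: "('j::finite, 'k::finite, 'i::finite) tensor set"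
  assumes "negligible B"
  shows "negligible {Z :: ('i, 'j, 'k) tensor. cyc Z \<in> B}"
proof (rule negligible_subset)
  have "bounded_linear (\<lambda>X :: ('j, 'k, 'i) tensor. cyc (cyc X))"
    using bounded_linear_compose[OF bounded_linear_cyc bounded_linear_cyc] .
  then show "negligible ((\<lambda>X. cyc (cyc X)) ` B)"
    using assms
    by (intro negligible_differentiable_image_negligible bounded_linear_imp_differentiable_on) (simp_all add: mult_ac)
  show "{Z. cyc Z \<in> B} \<subseteq> (\<lambda>X. cyc (cyc X)) ` B"
    by (auto intro!: image_eqI[of _ _ "cyc _"] simp: cyc_cyc_cyc)
qed

lemma cyc_S2_iff: "cyc X \<in> S2 \<longleftrightarrow> X \<in> S2"
  using cyc_S2[of X] cyc_S2[OF cyc_S2[of "cyc X"]] by (auto simp: cyc_cyc_cyc)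

section \<open>Reduction to the flat case and conclusion\<close>

lemma best_rank2_approx_flat:
  assumes best: "best_rank2_approx Z (outer a1 b1 c1 + outer a2 b2 c2)"
    and c: "\<not> indep2 c1 c2" and Z: "Z \<notin> S2"
  shows "\<exists>a1 a2 b1 b2 c. indep2 a1 a2 \<and> indep2 b1 b2 \<and> c \<noteq> 0
    \<and> best_rank2_approx Z (outer a1 b1 c + outer a2 b2 c)"
proof -
  obtain c s t where c1: "c1 = s *\<^sub>R c" and c2: "c2 = t *\<^sub>R c" using not_indep2E[OF c] .
  \<comment> \<open>With a common third factor, dependence in another mode would merge the two terms
    into one outer product, which is excluded here.\<close>
  have rank1: False if "outer a1 b1 c1 + outer a2 b2 c2 = outer x y z" for x y z
    using best_rank2_approx_rank_gt_2[of Z x y z] best Z that by (simp add: S2_def)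
  have Y: "outer a1 b1 c1 + outer a2 b2 c2 = outer a1 (s *\<^sub>R b1) c + outer a2 (t *\<^sub>R b2) c"
    by (simp add: c1 c2 flip: scaleR_outer)
  have "indep2 a1 a2"
  proof (rule ccontr)
    assume "\<not> indep2 a1 a2"
    then obtain x u v where "a1 = u *\<^sub>R x" "a2 = v *\<^sub>R x" by (rule not_indep2E)
    then have "outer a1 b1 c1 + outer a2 b2 c2 = outer x (u *\<^sub>R s *\<^sub>R b1 + v *\<^sub>R t *\<^sub>R b2) c"
      unfolding Y by (simp add: vec_eq_iff algebra_simps)
    then show False by (rule rank1)
  qed
  moreover have "indep2 (s *\<^sub>R b1) (t *\<^sub>R b2)"
  proof (rule ccontr)
    assume "\<not> indep2 (s *\<^sub>R b1) (t *\<^sub>R b2)"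
    then obtain x u v where "s *\<^sub>R b1 = u *\<^sub>R x" "t *\<^sub>R b2 = v *\<^sub>R x" by (rule not_indep2E)
    then have "outer a1 b1 c1 + outer a2 b2 c2 = outer (u *\<^sub>R a1 + v *\<^sub>R a2) x c"
      unfolding Y by (simp add: vec_eq_iff algebra_simps)
    then show False by (rule rank1)
  qed
  moreover have "c \<noteq> 0"
  proof
    assume "c = 0"
    then have "outer a1 b1 c1 + outer a2 b2 c2 = outer 0 0 0"
      unfolding Y by (simp add: vec_eq_iff)
    then show False by (rule rank1)
  qed
  ultimately show ?thesis using best unfolding Y by blast
qed

theorem corollary4p2:
  assumes "CARD('i::finite) \<ge> 2" and "CARD('j::finite) \<ge> 2" and "CARD('k::finite) \<ge> 2"
  shows "AE Z :: ('i, 'j, 'k) tensor in lebesgue.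
    tensor_rank Z > 2 \<longrightarrow>
    (\<forall>X. locally_best_M222_approx Z X \<longrightarrow> tensor_rank X = 3) \<longrightarrow>
    \<not> (\<exists>Y. best_rank2_approx Z Y)"
proof -
  \<comment> \<open>The digit in \<open>F1\<close>, \<open>F2\<close>, \<open>F3\<close> is the
    original mode in which the best approximation is flat.\<close>
  define F3 :: "('i, 'j, 'k) tensor set" where "F3 = {Z. \<exists>a1 a2 b1 b2 c.
    indep2 a1 a2 \<and> indep2 b1 b2 \<and> c \<noteq> 0 \<and> best_rank2_approx Z (outer a1 b1 c + outer a2 b2 c)}"
  define F1 :: "('j, 'k, 'i) tensor set" where "F1 = {Z. \<exists>a1 a2 b1 b2 c.
    indep2 a1 a2 \<and> indep2 b1 b2 \<and> c \<noteq> 0 \<and> best_rank2_approx Z (outer a1 b1 c + outer a2 b2 c)}"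
  define F2 :: "('k, 'i, 'j) tensor set" where "F2 = {Z. \<exists>a1 a2 b1 b2 c.
    indep2 a1 a2 \<and> indep2 b1 b2 \<and> c \<noteq> 0 \<and> best_rank2_approx Z (outer a1 b1 c + outer a2 b2 c)}"
  let ?N = "F3 \<union> {Z. cyc Z \<in> F1} \<union> {Z. cyc Z \<in> {Z. cyc Z \<in> F2}}"
  have "negligible ?N"
    using assms unfolding F1_def F2_def F3_def
    by (intro negligible_Un negligible_cyc_vimage negligible_flat_best_rank2_approx)
  moreover have "Z \<in> ?N" if rank: "tensor_rank Z > 2"
    and loc: "\<And>X. locally_best_M222_approx Z X \<Longrightarrow> tensor_rank X = 3"
    and best: "best_rank2_approx Z Y" for Z Y :: "('i, 'j, 'k) tensor"
  proof -
    obtain a1 b1 c1 a2 b2 c2 where Y: "Y = outer a1 b1 c1 + outer a2 b2 c2"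
      using best unfolding best_rank2_approx_def mem_S2_iff by blast
    have not_S2: "Z \<notin> S2" using rank by (simp add: S2_def)
    have "\<not> (indep2 a1 a2 \<and> indep2 b1 b2 \<and> indep2 c1 c2)"
    proof
      assume "indep2 a1 a2 \<and> indep2 b1 b2 \<and> indep2 c1 c2"
      then obtain e where "e > 0" and e: "\<And>X. X \<in> M222 \<Longrightarrow> norm (X - Y) < e \<Longrightarrow> X \<in> S2"
        unfolding Y using M222_subset_S2_near by blast
      \<comment> \<open>Near \<open>Y\<close> all competitors from \<open>M222\<close> lie in
        \<open>S2\<close>, over which \<open>Y\<close> is a global minimizer.\<close>
      have "locally_best_M222_approx Z Y"
        unfolding locally_best_M222_approx_def
        using \<open>e > 0\<close> e best S2_subset_M222 unfolding best_rank2_approx_def by blast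
      then have "tensor_rank Y = 3" by (rule loc)
      then show False using best by (simp add: best_rank2_approx_def S2_def)
    qed
    then consider "\<not> indep2 c1 c2" | "\<not> indep2 a1 a2" | "\<not> indep2 b1 b2" by blast
    then show ?thesis
    proof cases
      case 1
      have "Z \<in> F3"
        using best_rank2_approx_flat[OF best[unfolded Y] 1 not_S2] by (simp add: F3_def)
      then show ?thesis by simp
    next
      case 2
      have "cyc Z \<in> F1"
        using best_rank2_approx_flat[of "cyc Z" b1 c1 a1 b2 c2 a2] best_rank2_approx_cyc[OF best] 2 not_S2
        by (simp add: F1_def Y cyc_add cyc_outer cyc_S2_iff)
      then show ?thesis by simp
    next
      case 3
      have "cyc (cyc Z) \<in> F2"
        using best_rank2_approx_flat[of "cyc (cyc Z)" c1 a1 b1 c2 a2 b2] best_rank2_approx_cyc[OF best_rank2_approx_cyc[OF best]] 3 not_S2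
        by (simp add: F2_def Y cyc_add cyc_outer cyc_S2_iff)
      then show ?thesis by simp
    qed
  qed
  ultimately show ?thesis
    unfolding negligible_iff_null_sets by (intro AE_I'[of ?N]) blast+
qed

end
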